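(* Define the sequence $c$ by $c(1)=2$ and, for $n\ge 2$, $$c(n)=c(n-1)+\begin{cases}\gcd(n,\,c(n-1)), & n \text{ even},\\ \gcd(n-2,\,c(n-1)), & n\text{ odd}.\end{cases}$$ Call $n$ a fundamental point if $c(n)=2n$, and list the fundamental points in increasing order as $m_1<m_2<\cdots$. For $i\ge 2$ with $m_i$ existing, let $\rho^{(i)}$ be the largest integer $n<m_i$ with $c(n)-c(n-1)>1$, and put $n_{i-1}=m_{i-1}+3$ and $\lambda_i=\rho^{(i)}/n_{i-1}$. Suppose (Conjecture 4) that for every $i\ge 6$ the fundamental point $m_i$ exists and $\lambda_i\le 5/4$. Then there are infinitely many twin primes. *)

theory Defs
  imports Complex_Main "HOL-Library.Infinite_Set" "HOL-Computational_Algebra.Primes"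
begin

text \<open>The value at \<open>0\<close> is a dummy: the sequence is indexed by the positive integers,
  and nothing below evaluates it at \<open>0\<close>.\<close>

fun cseq :: "nat \<Rightarrow> nat" where
  "cseq n = (if n \<le> 1 then 2
             else cseq (n - 1) + (if even n then gcd n (cseq (n - 1))
                                  else gcd (n - 2) (cseq (n - 1))))"

declare cseq.simps [simp del]

text \<open>The parameter \<open>s\<close> says where the list \<open>m\<^sub>1 < m\<^sub>2 < \<dots>\<close> of fundamental points starts; it is
  only meant to be \<open>1\<close> or \<open>2\<close>.  Since \<open>c 1 = 2\<close>, the point \<open>1\<close> satisfies the equation, and for
  \<open>s = 1\<close> the list is \<open>1, 2, 6, 12, 42, 138, 312, \<dots>\<close>.  With that numbering
  \<open>\<lambda>\<^sub>6 = 79/45 > 5/4\<close>, whereas the numbering that skips the initial value (\<open>s = 2\<close>, list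
  \<open>2, 6, 12, 42, 138, 312, \<dots>\<close>) gives \<open>\<lambda>\<^sub>5 = 79/45\<close> and \<open>\<lambda>\<^sub>6 = 156/141\<close>, so that \<open>6\<close> is the first
  index from which the bound \<open>5/4\<close> can hold.\<close>

definition fundamental_points :: "nat \<Rightarrow> nat set" where
  "fundamental_points s = {n. s \<le> n \<and> cseq n = 2 * n}"

definition fund_exists :: "nat \<Rightarrow> nat \<Rightarrow> bool" where
  "fund_exists s i \<longleftrightarrow>
     1 \<le> i \<and> (finite (fundamental_points s) \<longrightarrow> i \<le> card (fundamental_points s))"

text \<open>\<^const>\<open>enumerate\<close> counts from \<open>0\<close>, the list of fundamental points from \<open>1\<close>.\<close>

definition fund :: "nat \<Rightarrow> nat \<Rightarrow> nat" where
  "fund s i = enumerate (fundamental_points s) (i - 1)"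

text \<open>The condition \<open>c n - c (n - 1) > 1\<close> is written without subtraction; it makes sense
  for \<open>n \<ge> 2\<close> only.\<close>

definition rho :: "nat \<Rightarrow> nat \<Rightarrow> nat" where
  "rho s i = Max {n. 2 \<le> n \<and> n < fund s i \<and> cseq n > cseq (n - 1) + 1}"

definition lam :: "nat \<Rightarrow> nat \<Rightarrow> real" where
  "lam s i = real (rho s i) / real (fund s (i - 1) + 3)"

end

theory Submission
  imports Defs
begin

text \<open>
  Let \<open>m\<close> be a fundamental point with \<open>m mod 3 \<noteq> 1\<close> and \<open>M\<close> the next one. Then
  \<open>c (m + 3) = 3 (m + 1)\<close>, and since \<open>c n - n\<close> never decreases, \<open>M \<ge> 2 m\<close>. Moreover
  \<open>c n - 2 n\<close> drops by at most \<open>1\<close> per step, so \<open>M\<close> is reached by increments \<open>1\<close> only from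
  \<open>\<rho>\<close> on: \<open>c n = M + n\<close> for \<open>\<rho> \<le> n \<le> M\<close>. A prime \<open>q\<close> dividing \<open>M - 1\<close> (respectively
  \<open>M + 1\<close>) would force a larger increment at \<open>n = M - 1 - q\<close> (respectively at
  \<open>n = M + 3 - 2 q\<close>). As \<open>\<lambda> \<le> 5/4\<close> makes the interval from \<open>\<rho>\<close> to \<open>M\<close> longer than
  \<open>2 \<surd>M\<close>, neither number has a small prime factor, so \<open>M - 1\<close> and \<open>M + 1\<close> are twin primes.
\<close>

section \<open>Growth and parity of the sequence\<close>

lemma cseq_Suc:
  assumes "1 \<le> n"
  shows "cseq (Suc n) =
    cseq n + (if odd n then gcd (Suc n) (cseq n) else gcd (n - 1) (cseq n))"
  using assms by (subst cseq.simps) auto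

lemma cseq_pos: "0 < cseq n"
  by (induction n rule: cseq.induct) (subst cseq.simps, auto)

lemma cseq_Suc_gt:
  assumes "1 \<le> n"
  shows "cseq n < cseq (Suc n)"
  using assms cseq_pos[of n] by (auto simp: cseq_Suc gcd_pos_nat)

lemma cseq_add_le:
  assumes "1 \<le> a" "a \<le> b"
  shows "cseq a + b \<le> cseq b + a"
  using assms(2)
proof (induction b rule: dec_induct)
  case (step n)
  then show ?case using cseq_Suc_gt[of n] assms(1) by simp
qed simp

text \<open>From index 2 on every increment is odd, since one argument of the gcd is odd:
  \<open>cseq n\<close> for odd \<open>n\<close>, and \<open>n - 1\<close> for even
  \<open>n\<close>. So the parity flips at each step. It starts at 2 because
  \<open>cseq 1 = 2\<close>.\<close>

lemma even_cseq_iff: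
  assumes "2 \<le> n"
  shows "even (cseq n) \<longleftrightarrow> even n"
  using assms
proof (induction n rule: dec_induct)
  case base
  have "cseq (Suc 0) = 2" by (subst cseq.simps) simp
  then have "cseq 2 = 4" using cseq_Suc[of 1] by (simp add: numeral_2_eq_2)
  then show ?case by simp
next
  case (step n)
  have "odd (gcd (Suc n) (cseq n))" if "odd n"
    using that step by (metis gcd_dvd2 dvd_trans)
  moreover have "odd (gcd (n - 1) (cseq n))" if "even n"
  proof -
    have "odd (n - 1)" using that step by simp
    then show ?thesis by (metis gcd_dvd1 dvd_trans)
  qed
  ultimately show ?case using step cseq_Suc[of n] by auto
qed

lemma fundamental_even:
  assumes "2 \<le> m" "cseq m = 2 * m"
  shows "even m"
  using even_cseq_iff[OF assms(1)] assms(2) by simp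

section \<open>The values just after a fundamental point\<close>

lemma cseq_fundamental_plus1:
  assumes "2 \<le> m" "cseq m = 2 * m"
  shows "cseq (m + 1) = 2 * m + 1"
proof -
  have ev: "even m" by (rule fundamental_even[OF assms])
  have "coprime (m - 1) m" using assms(1) coprime_diff_one_left_nat[of m] by simp
  moreover have "coprime (m - 1) 2" using ev assms(1) by simp
  ultimately have "gcd (m - 1) (2 * m) = 1" by simp
  then show ?thesis using cseq_Suc[of m] assms ev by simp
qed

lemma cseq_fundamental_plus2:
  assumes "2 \<le> m" "cseq m = 2 * m"
  shows "cseq (m + 2) = 2 * m + 1 + gcd (m + 2) 3"
proof -
  have ev: "even m" by (rule fundamental_even[OF assms])
  have "gcd (m + 2) (2 * m + 1) = gcd (m + 2) 3"
  proof (rule gcd_unique_nat[THEN iffD1, symmetric], intro conjI allI impI)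
    let ?d = "gcd (m + 2) 3"
    have "2 * m + 1 + 3 = 2 * (m + 2)" by simp
    then have "?d dvd 2 * m + 1 + 3" by (metis dvd_mult gcd_dvd1)
    then show "?d dvd 2 * m + 1" by (metis dvd_add_left_iff gcd_dvd2)
    show "?d dvd m + 2" by simp
    fix e assume e: "e dvd m + 2 \<and> e dvd 2 * m + 1"
    have "e dvd 2 * m + 1 + 3" using e \<open>2 * m + 1 + 3 = 2 * (m + 2)\<close> by (metis dvd_mult)
    then have "e dvd 3" using e by (metis dvd_add_right_iff)
    then show "e dvd ?d" using e by simp
  qed
  then show ?thesis
    using cseq_Suc[of "m + 1"] cseq_fundamental_plus1[OF assms] ev by simp
qed

lemma gcd_add2_3:
  "gcd (m + 2) (3::nat) = (if m mod 3 = 1 then 3 else 1)"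
proof -
  have "3 dvd m + 2 \<longleftrightarrow> m mod 3 = 1" by presburger
  moreover have "prime (3::nat)" by (rule prime_nat_numeral_eq[THEN iffD2]) simp
  ultimately show ?thesis
    by (metis coprime_commute coprime_iff_gcd_eq_1 gcd_nat.absorb2 prime_imp_coprime)
qed

text \<open>Disposes of the residue 1: here \<open>m + 2\<close> is again fundamental and divisible
  by 3, so it can replace \<open>m\<close>.\<close>

lemma fundamental_plus2:
  assumes "2 \<le> m" "cseq m = 2 * m" "m mod 3 = 1"
  shows "cseq (m + 2) = 2 * (m + 2)"
  using cseq_fundamental_plus2[OF assms(1,2)] assms(3) gcd_add2_3[of m] by simp

lemma cseq_fundamental_plus3:
  assumes "2 \<le> m" "cseq m = 2 * m" "m mod 3 \<noteq> 1"
  shows "cseq (m + 2) = 2 * m + 2" "cseq (m + 3) = 3 * m + 3"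
proof -
  have ev: "even m" by (rule fundamental_even[OF assms(1,2)])
  show *: "cseq (m + 2) = 2 * m + 2"
    using cseq_fundamental_plus2[OF assms(1,2)] assms(3) gcd_add2_3[of m] by simp
  \<comment> \<open>The index \<open>m + 3\<close> is odd, so the gcd is taken with
    \<open>m + 3 - 2 = m + 1\<close>, which divides \<open>cseq (m + 2)\<close>.\<close>
  have "gcd (m + 1) (2 * m + 2) = m + 1" by (rule gcd_nat.absorb1, rule dvdI[of _ _ 2]) simp
  then show "cseq (m + 3) = 3 * m + 3"
    using cseq_Suc[of "m + 2"] * ev by (simp add: numeral_3_eq_3)
qed

section \<open>Between consecutive fundamental points\<close>

lemma cseq_gt_before_next:
  assumes "2 \<le> m" "cseq m = 2 * m" "m mod 3 \<noteq> 1"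
    and none: "\<And>n. m < n \<Longrightarrow> n < M \<Longrightarrow> cseq n \<noteq> 2 * n"
    and "4 \<le> m" "m + 3 \<le> n" "n < M"
  shows "2 * n < cseq n"
  using \<open>m + 3 \<le> n\<close> \<open>n < M\<close>
proof (induction n rule: dec_induct)
  case base
  \<comment> \<open>The excess of \<open>cseq (m + 3)\<close> over \<open>2 * (m + 3)\<close> is
    \<open>m - 3\<close>, whence \<open>4 \<le> m\<close>.\<close>
  then show ?case using cseq_fundamental_plus3[OF assms(1-3)] assms(5) by simp
next
  case (step n)
  then have "2 * n < cseq n" by simp
  then have "2 * Suc n \<le> cseq (Suc n)" using cseq_Suc_gt[of n] step by simp
  moreover have "cseq (Suc n) \<noteq> 2 * Suc n" using none[of "Suc n"] step by simp
  ultimately show ?case by simp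
qed

text \<open>Parity excludes \<open>m + 1\<close> and \<open>m + 3\<close>, the value at
  \<open>m + 2\<close> excludes that index. Comparing \<open>c n - n\<close> at \<open>m + 3\<close>
  and at \<open>M\<close> then gives \<open>2 * m \<le> M\<close>.\<close>

lemma next_fundamental_ge:
  assumes "2 \<le> m" "cseq m = 2 * m" "m mod 3 \<noteq> 1"
    and "m < M" "cseq M = 2 * M"
  shows "m + 4 \<le> M" "2 * m \<le> M"
proof -
  have "even m" "even M"
    using fundamental_even[of m] fundamental_even[of M] assms by auto
  moreover have "M \<noteq> m + 2"
    using cseq_fundamental_plus3(1)[OF assms(1-3)] assms(5) by auto
  ultimately show "m + 4 \<le> M" using \<open>m < M\<close> by presburger
  then show "2 * m \<le> M"
    using cseq_add_le[of "m + 3" M] cseq_fundamental_plus3(2)[OF assms(1-3)] assms(5) by simp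
qed

lemma cseq_before_next:
  assumes "2 \<le> m" "cseq m = 2 * m" "m mod 3 \<noteq> 1" "4 \<le> m"
    and none: "\<And>n. m < n \<Longrightarrow> n < M \<Longrightarrow> cseq n \<noteq> 2 * n"
    and "m < M" "cseq M = 2 * M"
    and triv: "\<And>n. r < n \<Longrightarrow> 2 \<le> n \<Longrightarrow> n < M \<Longrightarrow> cseq n \<le> cseq (n - 1) + 1"
    and "1 \<le> n" "r \<le> n" "n < M"
  shows "cseq n = M + n"
proof -
  note ge = next_fundamental_ge[OF assms(1-3) \<open>m < M\<close> \<open>cseq M = 2 * M\<close>]
  have "2 * (M - 1) < cseq (M - 1)"
    using cseq_gt_before_next[OF assms(1-3) none \<open>4 \<le> m\<close>, of M "M - 1"] ge by simp
  moreover have "cseq (M - 1) < cseq M" using cseq_Suc_gt[of "M - 1"] ge by simp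
  \<comment> \<open>The value lies strictly between \<open>2 * M - 2\<close> and
    \<open>2 * M\<close>; from here the induction runs downwards.\<close>
  ultimately have last: "cseq (M - 1) = M + (M - 1)"
    using \<open>cseq M = 2 * M\<close> by simp
  have "n \<le> M - 1" using \<open>n < M\<close> by simp
  then show ?thesis using assms(9,10)
  proof (induction n rule: inc_induct)
    case base
    show ?case by (rule last)
  next
    case (step k)
    then have "cseq (Suc k) = M + Suc k" by simp
    moreover have "cseq (Suc k) \<le> cseq k + 1" using triv[of "Suc k"] step by simp
    moreover have "cseq k < cseq (Suc k)" using cseq_Suc_gt[of k] step by simp
    ultimately show ?case by simp
  qed
qed

section \<open>Primality of the neighbours of the next fundamental point\<close>

lemma prime_if_no_small_factor:
  fixes n :: nat
  assumes "1 < n" "\<And>q. prime q \<Longrightarrow> q dvd n \<Longrightarrow> q * q \<le> n \<Longrightarrow> False"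
  shows "prime n"
proof (rule ccontr)
  assume "\<not> prime n"
  then obtain a where a: "a dvd n" "a \<noteq> 1" "a \<noteq> n"
    using assms(1) by (auto simp: prime_nat_iff)
  then obtain b where b: "n = a * b" by (elim dvdE)
  have ab: "n = a * b" "1 < a" "1 < b"
    using a b assms(1) by (cases a; cases b; auto)+
  have key: False if "n = x * y" "1 < x" "x \<le> y" for x y
  proof -
    obtain q where q: "prime q" "q dvd x" using prime_factor_nat[of x] \<open>1 < x\<close> by auto
    then have "q \<le> x" using \<open>1 < x\<close> by (simp add: dvd_imp_le)
    then have "q * q \<le> n" using that by (simp add: mult_le_mono)
    then show False using assms(2)[of q] q that by simp
  qed
  show False
    using key[of a b] key[of b a] ab by (metis mult.commute nat_le_linear)
qed

lemma twin_primes_around_next: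
  assumes "2 \<le> m" "cseq m = 2 * m" "m mod 3 \<noteq> 1" "100 \<le> m"
    and none: "\<And>n. m < n \<Longrightarrow> n < M \<Longrightarrow> cseq n \<noteq> 2 * n"
    and "m < M" "cseq M = 2 * M"
    and triv: "\<And>n. r < n \<Longrightarrow> 2 \<le> n \<Longrightarrow> n < M \<Longrightarrow> cseq n \<le> cseq (n - 1) + 1"
    and r: "4 * r \<le> 5 * (m + 3)"
  shows "prime (M - 1)" "prime (M + 1)"
proof -
  note ge = next_fundamental_ge[OF assms(1-3) \<open>m < M\<close> \<open>cseq M = 2 * M\<close>]
  have evM: "even M" using fundamental_even assms(1,6,7) by simp
  have val: "cseq n = M + n" if "1 \<le> n" "r \<le> n" "n < M" for n
    using cseq_before_next[OF assms(1-3) _ none \<open>m < M\<close> \<open>cseq M = 2 * M\<close> triv that] assms(4)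
    by simp
  \<comment> \<open>These bounds keep both indices \<open>n\<close> chosen below in the range of
    \<open>val\<close>. As \<open>2 * m \<le> M\<close>, \<open>r\<close> is at most about 5/8 of
    \<open>M\<close>, while \<open>q\<close> is of order \<surd>M.\<close>
  have small: "r + 2 * q < M + 2 \<and> r + q + 2 < M \<and> 2 * q \<le> M" if "q * q \<le> M + 1" for q
  proof -
    have "16 * q + 16 < 3 * M"
    proof (cases "q \<le> 10")
      case True
      then show ?thesis using ge assms(4) by simp
    next
      case False
      then have "11 * q \<le> q * q" by simp
      then show ?thesis using that False by linarith
    qed
    moreover have "8 * r \<le> 5 * M + 30" using r ge(2) by simp
    moreover have "200 \<le> M" using ge(2) assms(4) by simp
    ultimately show ?thesis by simp
  qed
  show "prime (M - 1)"
  proof (rule prime_if_no_small_factor)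
    show "1 < M - 1" using ge assms(4) by simp
    fix q assume q: "prime q" "q dvd M - 1" "q * q \<le> M - 1"
    have "odd (M - 1)" using evM \<open>m < M\<close> by simp
    then have oq: "odd q" using q(2) dvd_trans by blast
    have "1 < q" using q(1) prime_gt_1_nat by simp
    have "q * q \<le> M + 1" using q(3) by linarith
    note * = small[OF this]
    \<comment> \<open>Both \<open>Suc n = (M - 1) - q\<close> and
      \<open>M + n = (M - 1) + Suc n\<close> are multiples of \<open>q\<close>, so the increment
      after \<open>n\<close> is at least \<open>q\<close>, whereas \<open>val\<close> makes it
      1.\<close>
    define n where "n = M - 2 - q"
    have n: "r \<le> n" "1 \<le> n" "Suc n < M" "q + Suc n = M - 1"
      using * \<open>1 < q\<close> unfolding n_def by auto
    have "even (q + n)" using n(4) evM by presburger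
    then have "odd n" using oq by simp
    have "q dvd Suc n" using n(4) q(2) by (metis dvd_add_right_iff dvd_refl)
    moreover have "cseq n = (M - 1) + Suc n" using val[of n] n by simp
    ultimately have "q dvd gcd (Suc n) (cseq n)" using q(2) by (metis dvd_add gcd_greatest)
    then have "q \<le> gcd (Suc n) (cseq n)" by (rule dvd_imp_le) simp
    then have "cseq n + q \<le> cseq (Suc n)" using cseq_Suc[of n] n(2) \<open>odd n\<close> by simp
    then show False using val[of n] val[of "Suc n"] n \<open>1 < q\<close> by simp
  qed
  show "prime (M + 1)"
  proof (rule prime_if_no_small_factor)
    show "1 < M + 1" using \<open>m < M\<close> by simp
    fix q assume q: "prime q" "q dvd M + 1" "q * q \<le> M + 1"
    have oq: "odd q" using q(2) evM dvd_trans by (metis even_plus_one_iff)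
    have "2 \<le> q" using q(1) prime_ge_2_nat by simp
    then have "3 \<le> q" using oq by (cases "q = 2") auto
    \<comment> \<open>Now \<open>n\<close> must be even, so that the gcd involves
      \<open>n - 1\<close>. Subtracting \<open>2 * q\<close> instead of \<open>q\<close> achieves
      this, and \<open>n - 1 = (M + 1) - 2 * q\<close> is still a multiple of
      \<open>q\<close>.\<close>
    define n where "n = M + 2 - 2 * q"
    have n: "n + 2 * q = M + 2" "r \<le> n" "2 \<le> n" "Suc n < M"
      using small[OF q(3)] \<open>3 \<le> q\<close> unfolding n_def by auto
    have "even n" using n(1) evM by presburger
    have "(n - 1) + 2 * q = M + 1" using n(1,3) by simp
    then have "q dvd n - 1" using q(2) by (metis dvd_add_left_iff dvd_triv_right)
    moreover have "cseq n = (M + 1) + (n - 1)" using val[of n] n by simp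
    ultimately have "q dvd gcd (n - 1) (cseq n)" using q(2) by (metis dvd_add gcd_greatest)
    then have "q \<le> gcd (n - 1) (cseq n)" by (rule dvd_imp_le) (use n(3) in simp)
    then have "cseq n + q \<le> cseq (Suc n)" using cseq_Suc[of n] n(3) \<open>even n\<close> by simp
    then show False using val[of n] val[of "Suc n"] n \<open>3 \<le> q\<close> by simp
  qed
qed

section \<open>From the enumerated list to the twin primes\<close>

lemma infinite_fundamental_points:
  assumes "\<forall>i\<ge>k. fund_exists s i"
  shows "infinite (fundamental_points s)"
proof
  assume fin: "finite (fundamental_points s)"
  have "fund_exists s (k + Suc (card (fundamental_points s)))" using assms by simp
  then show False using fin by (simp add: fund_exists_def)
qed

lemma no_fundamental_between:
  assumes "infinite (fundamental_points s)" "2 \<le> i"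
    and "fund s (i - 1) < n" "n < fund s i"
  shows "n \<notin> fundamental_points s"
proof
  assume "n \<in> fundamental_points s"
  then obtain j where j: "enumerate (fundamental_points s) j = n"
    using enumerate_Ex assms(1) by blast
  \<comment> \<open>\<open>fund\<close> counts from 1 and \<open>enumerate\<close> from 0, so
    \<open>j\<close> would lie strictly between \<open>i - 2\<close> and
    \<open>i - 1\<close>.\<close>
  then have "i - 1 - 1 < j" "j < i - 1"
    using assms enumerate_mono_iff[OF assms(1)] unfolding fund_def by metis+
  then show False by simp
qed

lemma cseq_le_if_gt_rho:
  assumes "rho s i < n" "2 \<le> n" "n < fund s i"
  shows "cseq n \<le> cseq (n - 1) + 1"
proof (rule ccontr)
  assume "\<not> ?thesis"
  then have "n \<le> rho s i" unfolding rho_def using assms by (intro Max_ge) auto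
  then show False using assms(1) by simp
qed

theorem theorem4:
  fixes s :: nat
  assumes "s \<in> {1, 2}"
    and "\<forall>i\<ge>6. fund_exists s i \<and> lam s i \<le> 5 / 4"
  shows "infinite {p :: nat. prime p \<and> prime (p + 2)}"
proof -
  let ?F = "fundamental_points s"
  have inf: "infinite ?F" using infinite_fundamental_points[of 6 s] assms(2) by blast
  have "\<exists>p>k. p \<in> {p. prime p \<and> prime (p + 2)}" for k :: nat
  proof -
    \<comment> \<open>The summand \<open>k\<close> makes the primes exceed \<open>k\<close>, 1000
      covers \<open>100 \<le> m\<close>, and \<open>enumerate ?F 4\<close> pushes the index into the
      range of the hypothesis.\<close>
    obtain m0 where m0: "m0 > k + 1000 + enumerate ?F 4" "m0 \<in> ?F"
      using inf by (meson infinite_nat_iff_unbounded)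
    obtain m where m: "m \<in> ?F" "m \<ge> m0" "m mod 3 \<noteq> 1"
    proof (cases "m0 mod 3 = 1")
      case True
      then have "m0 + 2 \<in> ?F"
        using m0 fundamental_plus2[of m0] by (auto simp: fundamental_points_def)
      moreover have "(m0 + 2) mod 3 \<noteq> 1" using True by presburger
      ultimately show thesis using that[of "m0 + 2"] by simp
    qed (use m0 that in auto)
    obtain j where j: "enumerate ?F j = m" using m(1) inf enumerate_Ex by blast
    then have "4 < j" using enumerate_mono_iff[OF inf, of 4 j] m0 m(2) by simp
    \<comment> \<open>Counted from 1, \<open>m\<close> is point number \<open>j + 1\<close>, so
      \<open>i\<close> is the number of its successor \<open>M\<close>.\<close>
    define i where "i = j + 2"
    have fm: "fund s (i - 1) = m" using j by (simp add: fund_def i_def)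
    define M where "M = fund s i"
    have "m < M" using enumerate_step[OF inf, of j] j by (simp add: M_def fund_def i_def)
    have "M \<in> ?F" using enumerate_in_set[OF inf] by (simp add: M_def fund_def)
    then have cM: "cseq M = 2 * M" by (simp add: fundamental_points_def)
    have cm: "cseq m = 2 * m" using m(1) by (simp add: fundamental_points_def)
    have none: "cseq n \<noteq> 2 * n" if "m < n" "n < M" for n
      using no_fundamental_between[OF inf, of i n] that fm m(1)
      by (auto simp: i_def M_def fundamental_points_def)
    have "lam s i \<le> 5 / 4" using assms(2) \<open>4 < j\<close> by (simp add: i_def)
    then have "real (4 * rho s i) \<le> real (5 * (m + 3))"
      unfolding lam_def fm by (simp add: divide_simps)
    then have r: "4 * rho s i \<le> 5 * (m + 3)" by (simp only: of_nat_le_iff)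
    have "2 \<le> m" "100 \<le> m" using m0 m(2) by simp_all
    then have "prime (M - 1)" "prime (M + 1)"
      using twin_primes_around_next[OF _ cm m(3) _ none \<open>m < M\<close> cM _ r] cseq_le_if_gt_rho[of s i]
      by (simp_all add: M_def)
    moreover have "k < M - 1" "M - 1 + 2 = M + 1" using m0 m(2) \<open>m < M\<close> by simp_all
    ultimately show ?thesis by (intro exI[of _ "M - 1"]) simp
  qed
  then show ?thesis by (meson infinite_nat_iff_unbounded)
qed

end
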